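(* Consider the two-player lattice convex-quadratic simultaneous game in which the $x$-player solves $\min_{x\in\Lambda_1}\frac12 x^\top Q_1x+(C_1y+d_1)^\top x$ and the $y$-player solves $\min_{y\in\Lambda_2}\frac12 y^\top Q_2y+(C_2x+d_2)^\top y$, where $\Lambda_1\subset\mathbb{R}^{n_x}$ and $\Lambda_2\subset\mathbb{R}^{n_y}$ are full-rank lattices, and $Q_1,Q_2$ are symmetric positive definite. If the game has negatively adequate objectives (every singular value of $R_1=Q_1^{-1}C_1$ and of $R_2=Q_2^{-1}C_2$ is strictly greater than $1$), then for all but finitely many initial points $(\hat x^0,\hat y^0)\in\Lambda_1\times\Lambda_2$ the Best-Response Algorithm generates divergent iterates.
   Context: Here $C_1\in\mathbb{R}^{n_x\times n_y}$, $C_2\in\mathbb{R}^{n_y\times n_x}$, $d_1\in\mathbb{R}^{n_x}$, $d_2\in\mathbb{R}^{n_y}$. A full-rank lattice in $\mathbb{R}^n$ is the set of all integer combinations of $n$ linearly independent vectors of $\mathbb{R}^n$. The singular values of an $m\times n$ real matrix $M$ are the square roots of the $n$ eigenvalues of $M^\top M$ (so an $m\times n$ matrix has $n$ singular values counted with multiplicity, possibly zero). Best responses: $\mathcal{B}_1(y)$ denotes an element of $\arg\min_{x\in\Lambda_1}\{\frac12x^\top Q_1x+(C_1y+d_1)^\top x\}$ and $\mathcal{B}_2(x)$ denotes an element of $\arg\min_{y\in\Lambda_2}\{\frac12y^\top Q_2y+(C_2x+d_2)^\top y\}$; if there are several minimizers an arbitrary one is chosen. Best-Response Algorithm: given $(\hat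 x^0,\hat y^0)\in\Lambda_1\times\Lambda_2$, for $i=1,2,\dots$ set $\hat x^i=\mathcal{B}_1(\hat y^{i-1})$ and $\hat y^i=\mathcal{B}_2(\hat x^{i-1})$; if $(\hat x^i,\hat y^i)=(\hat x^k,\hat y^k)$ for some $k<i$, terminate. The iterates are divergent if the algorithm never terminates and $\|(\hat x^i,\hat y^i)\|_2\to\infty$ as $i\to\infty$. *)

theory Defs
  imports "HOL-Analysis.Analysis"
begin

definition full_rank_lattice :: "(real ^ 'n) set \<Rightarrow> bool" where
  "full_rank_lattice L \<longleftrightarrow>
     (\<exists>B. independent B \<and> card B = CARD('n) \<and>
          L = {\<Sum>b\<in>B. real_of_int (c b) *\<^sub>R b | c. True})"

definition sym_pos_def :: "real ^ 'n ^ 'n \<Rightarrow> bool" where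
  "sym_pos_def Q \<longleftrightarrow> transpose Q = Q \<and> (\<forall>v. v \<noteq> 0 \<longrightarrow> v \<bullet> (Q *v v) > 0)"

definition eigenvalues :: "real ^ 'n ^ 'n \<Rightarrow> real set" where
  "eigenvalues A = {l. \<exists>v. v \<noteq> 0 \<and> A *v v = l *\<^sub>R v}"

(* The matrix transpose M ** M is indexed by the columns of M, so 0 is a singular value
   of every matrix with more columns than rows. All eigenvalues of this Gram matrix are
   real and nonnegative; multiplicities are not recorded. *)
definition singular_values :: "real ^ 'n ^ 'm \<Rightarrow> real set" where
  "singular_values M = sqrt ` eigenvalues (transpose M ** M)"

definition negatively_adequate ::
  "real ^ 'x ^ 'x \<Rightarrow> real ^ 'y ^ 'y \<Rightarrow> real ^ 'y ^ 'x \<Rightarrow> real ^ 'x ^ 'y \<Rightarrow> bool" where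
  "negatively_adequate Q1 Q2 C1 C2 \<longleftrightarrow>
     (\<forall>s \<in> singular_values (matrix_inv Q1 ** C1). s > 1) \<and>
     (\<forall>s \<in> singular_values (matrix_inv Q2 ** C2). s > 1)"

(* z is the opponent's decision, w the player's own decision. *)
definition objective ::
  "real ^ 'n ^ 'n \<Rightarrow> real ^ 'm ^ 'n \<Rightarrow> real ^ 'n \<Rightarrow> real ^ 'm \<Rightarrow> real ^ 'n \<Rightarrow> real" where
  "objective Q C d z w = 1 / 2 * (w \<bullet> (Q *v w)) + (C *v z + d) \<bullet> w"

definition best_response ::
  "(real ^ 'n) set \<Rightarrow> real ^ 'n ^ 'n \<Rightarrow> real ^ 'm ^ 'n \<Rightarrow> real ^ 'n \<Rightarrow> real ^ 'm \<Rightarrow> real ^ 'n \<Rightarrow> bool"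
  where
  "best_response L Q C d z w \<longleftrightarrow> is_arg_min (objective Q C d z) (\<lambda>u. u \<in> L) w"

(* Ties between minimizers may be broken arbitrarily, and differently in every step; in
   particular all fixed selections B1, B2 of best responses are covered. The sequences are
   infinite: a run of the algorithm that stops is represented by its continuations past the
   stopping iteration, and stopping shows up as a repetition in the sequence. *)
definition best_response_iterates ::
  "(real ^ 'x) set \<Rightarrow> real ^ 'x ^ 'x \<Rightarrow> real ^ 'y ^ 'x \<Rightarrow> real ^ 'x \<Rightarrow>
   (real ^ 'y) set \<Rightarrow> real ^ 'y ^ 'y \<Rightarrow> real ^ 'x ^ 'y \<Rightarrow> real ^ 'y \<Rightarrow>
   real ^ 'x \<Rightarrow> real ^ 'y \<Rightarrow> (nat \<Rightarrow> real ^ 'x) \<Rightarrow> (nat \<Rightarrow> real ^ 'y) \<Rightarrow> bool" where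
  "best_response_iterates L1 Q1 C1 d1 L2 Q2 C2 d2 x0 y0 X Y \<longleftrightarrow>
     X 0 = x0 \<and> Y 0 = y0 \<and>
     (\<forall>i\<ge>1. best_response L1 Q1 C1 d1 (Y (i - 1)) (X i) \<and>
            best_response L2 Q2 C2 d2 (X (i - 1)) (Y i))"

definition terminates :: "(nat \<Rightarrow> 'a) \<Rightarrow> (nat \<Rightarrow> 'b) \<Rightarrow> bool" where
  "terminates X Y \<longleftrightarrow> (\<exists>i\<ge>1. \<exists>k<i. (X i, Y i) = (X k, Y k))"

(* The norm on pairs is the Euclidean norm of the concatenated vector. *)
definition divergent_iterates :: "(nat \<Rightarrow> real ^ 'x) \<Rightarrow> (nat \<Rightarrow> real ^ 'y) \<Rightarrow> bool" where
  "divergent_iterates X Y \<longleftrightarrow>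
     \<not> terminates X Y \<and> filterlim (\<lambda>i. norm (X i, Y i)) at_top sequentially"

end

theory Submission
  imports Defs
begin

text \<open>
  A best response lies within bounded distance of the unconstrained minimizer
  \<open>-Q\<^sup>-\<^sup>1(C z + d)\<close>, because the lattice meets every sufficiently large ball and the objective is, up to
  a constant, half the squared distance to that minimizer in a norm equivalent to the Euclidean one.
  Adequacy gives \<open>\<parallel>R v\<parallel> \<ge> \<sigma> \<parallel>v\<parallel>\<close> with \<open>\<sigma> > 1\<close>. Hence \<open>m\<^sub>i = max \<parallel>x\<^sup>i\<parallel> \<parallel>y\<^sup>i\<parallel>\<close> satisfies
  \<open>m\<^sub>i\<^sub>+\<^sub>1 \<ge> \<sigma> m\<^sub>i - K\<close>, so it increases strictly to infinity as soon as \<open>m\<^sub>0 > K / (\<sigma> - 1)\<close>, and only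
  finitely many lattice points violate this.
\<close>

section \<open>Full-rank lattices: covering and local finiteness\<close>

lemma full_rank_lattice_basis:
  fixes L :: "(real ^ 'n) set"
  assumes "full_rank_lattice L"
  obtains B where "independent B" "finite B" "span B = UNIV"
    "L = {\<Sum>b\<in>B. real_of_int (c b) *\<^sub>R b | c. True}"
proof -
  obtain B where B: "independent B" "card B = CARD('n)"
    and L: "L = {\<Sum>b\<in>B. real_of_int (c b) *\<^sub>R b | c. True}"
    using assms unfolding full_rank_lattice_def by blast
  have fin: "finite B" using B(1) by (rule independent_imp_finite)
  have "UNIV \<subseteq> span B"
    by (rule card_ge_dim_independent) (use B in auto)
  then show thesis using that B(1) fin L by blast
qed

text \<open>Rounding down the coordinates of a point in the lattice basis moves each of them by at
  most 1, so the sum of the norms of the basis vectors serves as a radius.\<close>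

lemma full_rank_lattice_covering:
  fixes L :: "(real ^ 'n) set"
  assumes "full_rank_lattice L"
  obtains K where "\<And>v. \<exists>w\<in>L. norm (w - v) \<le> K"
proof -
  obtain B where B: "independent B" "finite B" "span B = UNIV"
    and L: "L = {\<Sum>b\<in>B. real_of_int (c b) *\<^sub>R b | c. True}"
    using full_rank_lattice_basis[OF assms] .
  have "\<exists>w\<in>L. norm (w - v) \<le> (\<Sum>b\<in>B. norm b)" for v
  proof -
    define r where "r = representation B v"
    define w where "w = (\<Sum>b\<in>B. real_of_int \<lfloor>r b\<rfloor> *\<^sub>R b)"
    have v: "v = (\<Sum>b\<in>B. r b *\<^sub>R b)"
      unfolding r_def using sum_representation_eq[of B v B] B by simp
    have "norm (w - v) = norm (\<Sum>b\<in>B. (real_of_int \<lfloor>r b\<rfloor> - r b) *\<^sub>R b)"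
      unfolding w_def by (subst v) (simp add: sum_subtractf scaleR_left_diff_distrib)
    also have "\<dots> \<le> (\<Sum>b\<in>B. norm b)"
    proof (rule sum_norm_le)
      fix b
      have "\<bar>real_of_int \<lfloor>r b\<rfloor> - r b\<bar> \<le> 1" by linarith
      then show "norm ((real_of_int \<lfloor>r b\<rfloor> - r b) *\<^sub>R b) \<le> norm b"
        using mult_right_mono[of _ 1 "norm b"] by fastforce
    qed
    finally show ?thesis
      by (intro bexI[of _ w]) (use L w_def in auto)
  qed
  then show thesis using that by blast
qed

text \<open>Coordinates in the basis are bounded linear functionals, so the integer coordinates of
  lattice points in a ball lie in a finite box.\<close>

lemma full_rank_lattice_finite_Int_cball:
  fixes L :: "(real ^ 'n) set"
  assumes "full_rank_lattice L"
  shows "finite (L \<inter> cball 0 M)"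
proof -
  obtain B where B: "independent B" "finite B" "span B = UNIV"
    and L: "L = {\<Sum>b\<in>B. real_of_int (c b) *\<^sub>R b | c. True}"
    using full_rank_lattice_basis[OF assms] .
  have "\<exists>K. \<forall>v. \<bar>representation B v b\<bar> \<le> K * norm v" for b
  proof -
    obtain K where "\<And>v. norm (representation B v b) \<le> norm v * K"
      using bounded_linear.bounded[OF bounded_linear_representation] B(1,3) by blast
    then show ?thesis by (auto simp: mult.commute)
  qed
  then obtain K where K: "\<And>v b. \<bar>representation B v b\<bar> \<le> K b * norm v" by metis
  \<comment> \<open>Extensional functions make the box finite, since values outside \<open>B\<close>
    are irrelevant. The absolute value is there because the sign of the chosen \<open>K b\<close> is
    unknown.\<close>
  define F where "F = (\<Pi>\<^sub>E b\<in>B. {-\<lceil>\<bar>K b\<bar> * M\<rceil>..\<lceil>\<bar>K b\<bar> * M\<rceil>})"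
  have "L \<inter> cball 0 M \<subseteq> (\<lambda>c. \<Sum>b\<in>B. real_of_int (c b) *\<^sub>R b) ` F"
  proof
    fix v assume v: "v \<in> L \<inter> cball 0 M"
    then obtain c where c: "v = (\<Sum>b\<in>B. real_of_int (c b) *\<^sub>R b)" using L by auto
    have rep: "representation B v b = real_of_int (c b)" if "b \<in> B" for b
    proof -
      have "representation B v = (\<lambda>b. if b \<in> B then real_of_int (c b) else 0)"
        by (rule representation_eqI)
          (use B c in \<open>auto simp: span_base intro!: sum.mono_neutral_cong_left split: if_splits\<close>)
      then show ?thesis using that by simp
    qed
    have "restrict c B \<in> F"
      unfolding F_def
    proof (rule restrict_PiE_iff[THEN iffD2], rule ballI)
      fix b assume b: "b \<in> B"
      have "\<bar>real_of_int (c b)\<bar> \<le> K b * norm v" using K[of v b] rep[OF b] by simp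
      also have "\<dots> \<le> \<bar>K b\<bar> * M" using v by (intro mult_mono) auto
      finally show "c b \<in> {-\<lceil>\<bar>K b\<bar> * M\<rceil>..\<lceil>\<bar>K b\<bar> * M\<rceil>}"
        by (auto; linarith)
    qed
    moreover have "v = (\<Sum>b\<in>B. real_of_int (restrict c B b) *\<^sub>R b)" using c by simp
    ultimately show "v \<in> (\<lambda>c. \<Sum>b\<in>B. real_of_int (c b) *\<^sub>R b) ` F" by blast
  qed
  moreover have "finite F" unfolding F_def using B by (intro finite_PiE) auto
  ultimately show ?thesis using finite_surj by blast
qed

section \<open>Quadratic forms and their smallest eigenvalue\<close>

lemma symmetric_inner_matrix:
  fixes A :: "real ^ 'n ^ 'n"
  assumes "transpose A = A"
  shows "u \<bullet> (A *v v) = (A *v u) \<bullet> v"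
  using dot_lmul_matrix[of u A v] assms by (metis vector_transpose_matrix)

text \<open>The minimizer \<open>v\<close> of the quadratic form on the unit sphere is an eigenvector: otherwise moving it
  along \<open>-u\<close>, for the residual \<open>u = A v - l v\<close>, would decrease the Rayleigh quotient.\<close>

lemma Rayleigh_eigenvalue:
  fixes A :: "real ^ 'n ^ 'n"
  assumes sym: "transpose A = A"
  obtains l where "l \<in> eigenvalues A" "\<And>w. l * (norm w)\<^sup>2 \<le> w \<bullet> (A *v w)"
proof -
  have "continuous_on (sphere 0 1) (\<lambda>v. v \<bullet> (A *v v))"
    by (intro continuous_intros)
  then obtain v where v: "norm v = 1" and min: "\<And>u. norm u = 1 \<Longrightarrow> v \<bullet> (A *v v) \<le> u \<bullet> (A *v u)"
    using continuous_attains_inf[of "sphere 0 1 :: (real ^ 'n) set" "\<lambda>v. v \<bullet> (A *v v)"] by auto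
  define l where "l = v \<bullet> (A *v v)"
  have l: "l * (norm w)\<^sup>2 \<le> w \<bullet> (A *v w)" for w
  proof (cases "w = 0")
    case False
    have "l \<le> sgn w \<bullet> (A *v sgn w)"
      unfolding l_def by (rule min) (use False in \<open>simp add: norm_sgn\<close>)
    also have "\<dots> = (w \<bullet> (A *v w)) / (norm w)\<^sup>2"
      by (simp add: sgn_div_norm matrix_vector_mult_scaleR power2_eq_square divide_inverse)
    finally show ?thesis using False by (simp add: pos_le_divide_eq)
  qed simp
  define u where "u = A *v v - l *\<^sub>R v"
  define a where "a = u \<bullet> u"
  define b where "b = u \<bullet> (A *v u) - l * (norm u)\<^sup>2"
  have b: "b \<ge> 0" using l[of u] by (simp add: b_def)
  \<comment> \<open>This is the bound \<open>l\<close> evaluated at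
    \<open>v + t *\<^sub>R u\<close>; the terms constant in \<open>t\<close> cancel because
    \<open>v\<close> is a unit vector attaining the minimum.\<close>
  have "\<And>t. 0 \<le> 2 * t * a + t\<^sup>2 * b"
  proof -
    fix t
    have uAv: "u \<bullet> (A *v v) = a + l * (u \<bullet> v)"
      by (simp add: a_def u_def inner_diff_left inner_diff_right inner_commute algebra_simps)
    moreover have "v \<bullet> (A *v u) = a + l * (u \<bullet> v)"
      using symmetric_inner_matrix[OF sym, of u v] uAv by (simp add: inner_commute)
    moreover have "v \<bullet> v = 1" using v by (simp add: norm_eq_1)
    moreover have "(norm (v + t *\<^sub>R u))\<^sup>2 = v \<bullet> v + 2 * t * (u \<bullet> v) + t\<^sup>2 * (norm u)\<^sup>2"
      by (simp only: power2_norm_eq_inner) (simp add: algebra_simps inner_commute power2_eq_square)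
    moreover have "(v + t *\<^sub>R u) \<bullet> (A *v (v + t *\<^sub>R u))
        = l + t * (u \<bullet> (A *v v)) + t * (v \<bullet> (A *v u)) + t\<^sup>2 * (u \<bullet> (A *v u))"
      by (simp add: l_def matrix_vector_right_distrib matrix_vector_mult_scaleR algebra_simps
          power2_eq_square)
    ultimately show "0 \<le> 2 * t * a + t\<^sup>2 * b" using l[of "v + t *\<^sub>R u"]
      by (simp add: b_def algebra_simps power2_eq_square)
  qed
  \<comment> \<open>A negative step \<open>t\<close> at which the quadratic is negative unless
    \<open>a = 0\<close>. The minimizer would be \<open>- a / b\<close>; using \<open>b + 1\<close>
    avoids the case \<open>b = 0\<close>.\<close>
  moreover have "2 * (- a / (b + 1)) * a + (- a / (b + 1))\<^sup>2 * b = - (a\<^sup>2 * (b + 2) / (b + 1)\<^sup>2)"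
    using b by (simp add: divide_simps power2_eq_square) (simp add: algebra_simps)
  ultimately have "a\<^sup>2 * (b + 2) / (b + 1)\<^sup>2 \<le> 0"
    by (metis neg_0_le_iff_le)
  moreover have "(b + 2) / (b + 1)\<^sup>2 > 0" using b by simp
  ultimately have "a\<^sup>2 \<le> 0"
    by (metis mult_le_0_iff not_le times_divide_eq_right)
  then have "a = 0" by simp
  then have "A *v v = l *\<^sub>R v" by (simp add: a_def u_def)
  moreover have "v \<noteq> 0" using v by auto
  ultimately have "l \<in> eigenvalues A" unfolding eigenvalues_def by auto
  then show thesis using that l by blast
qed

text \<open>The form of \<open>transpose R ** R\<close> at \<open>w\<close> is the squared norm of
  \<open>R *v w\<close>. Its minimal Rayleigh quotient is an eigenvalue, so the root of that
  eigenvalue is a singular value and a uniform expansion factor.\<close>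

lemma expanding_if_singular_values_gt_1:
  fixes R :: "real ^ 'n ^ 'm"
  assumes "\<forall>s \<in> singular_values R. s > 1"
  obtains \<sigma> where "\<sigma> > 1" "\<And>v. \<sigma> * norm v \<le> norm (R *v v)"
proof -
  have "transpose (transpose R ** R) = transpose R ** R"
    by (simp add: matrix_transpose_mul)
  then obtain l where l: "l \<in> eigenvalues (transpose R ** R)"
    and min: "\<And>w. l * (norm w)\<^sup>2 \<le> w \<bullet> ((transpose R ** R) *v w)"
    by (rule Rayleigh_eigenvalue) blast
  have "sqrt l > 1" using l assms by (simp add: singular_values_def)
  moreover have "sqrt l * norm w \<le> norm (R *v w)" for w
  proof (rule power2_le_imp_le)
    have "w \<bullet> ((transpose R ** R) *v w) = (norm (R *v w))\<^sup>2"
      by (simp add: power2_norm_eq_inner inner_commute flip: matrix_vector_mul_assoc dot_lmul_matrix)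
    then show "(sqrt l * norm w)\<^sup>2 \<le> (norm (R *v w))\<^sup>2"
      using min[of w] \<open>sqrt l > 1\<close> by (simp add: power_mult_distrib)
  qed simp
  ultimately show thesis using that by blast
qed

text \<open>Turns pointwise positivity into a uniform bound: the minimal Rayleigh quotient is
  attained at an eigenvector, where positive definiteness makes it positive.\<close>

lemma sym_pos_def_coercive:
  assumes "sym_pos_def Q"
  obtains l where "l > 0" "\<And>w. l * (norm w)\<^sup>2 \<le> w \<bullet> (Q *v w)"
proof -
  obtain l where l: "l \<in> eigenvalues Q" and min: "\<And>w. l * (norm w)\<^sup>2 \<le> w \<bullet> (Q *v w)"
    using Rayleigh_eigenvalue assms unfolding sym_pos_def_def by metis
  obtain v where v: "v \<noteq> 0" "Q *v v = l *\<^sub>R v" using l unfolding eigenvalues_def by blast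
  have "v \<bullet> (Q *v v) > 0" using assms v(1) unfolding sym_pos_def_def by blast
  moreover have "v \<bullet> v > 0" using v(1) by simp
  ultimately have "l > 0" using v(2) by (simp add: zero_less_mult_iff del: inner_gt_zero_iff)
  then show thesis using that min by blast
qed

lemma sym_pos_def_matrix_inv:
  assumes "sym_pos_def Q"
  shows "Q *v (matrix_inv Q *v v) = v"
proof -
  have "Q *v x = 0 \<Longrightarrow> x = 0" for x
    using assms unfolding sym_pos_def_def by (metis inner_zero_right less_irrefl)
  then have "invertible Q"
    using matrix_left_invertible_ker[of Q] by (auto simp: invertible_left_inverse)
  then show ?thesis 
    using someI_ex[of "\<lambda>A'. Q ** A' = mat 1 \<and> A' ** Q = mat 1"]
    by (simp add: invertible_def matrix_inv_def matrix_vector_mul_assoc)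
qed

section \<open>Best responses as perturbed linear maps\<close>

lemma objective_complete_square:
  assumes "sym_pos_def Q" and "Q *v m = - (C *v z + d)"
  shows "objective Q C d z w = 1 / 2 * ((w - m) \<bullet> (Q *v (w - m))) - 1 / 2 * (m \<bullet> (Q *v m))"
proof -
  have "m \<bullet> (Q *v w) = w \<bullet> (Q *v m)"
    using symmetric_inner_matrix[of Q m w] assms(1) by (simp add: sym_pos_def_def inner_commute)
  moreover have "(C *v z + d) \<bullet> w = - (w \<bullet> (Q *v m))"
    unfolding assms(2) by (simp only: inner_minus_right minus_minus inner_commute)
  ultimately show ?thesis
    unfolding objective_def
    by (simp add: matrix_vector_mult_diff_distrib inner_diff_left inner_diff_right algebra_simps)
qed

text \<open>The constant is uniform in \<open>z\<close>: a best response is compared with a lattice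
  point near the unconstrained minimizer, and the form of \<open>Q\<close> lies between two positive
  multiples of the squared norm.\<close>

lemma best_response_near_linear:
  fixes L :: "(real ^ 'n) set" and C :: "real ^ 'm ^ 'n"
  assumes L: "full_rank_lattice L" and Q: "sym_pos_def Q"
  obtains K where "\<And>z w. best_response L Q C d z w \<Longrightarrow> norm (w + (matrix_inv Q ** C) *v z) \<le> K"
proof -
  obtain l where l: "l > 0" and low: "\<And>w. l * (norm w)\<^sup>2 \<le> w \<bullet> (Q *v w)"
    using sym_pos_def_coercive[OF Q] by blast
  obtain \<rho> where \<rho>: "\<And>v. \<exists>w\<in>L. norm (w - v) \<le> \<rho>"
    using full_rank_lattice_covering[OF L] by blast
  have "\<rho> \<ge> 0" using \<rho>[of 0] norm_ge_zero order_trans by blast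
  obtain c where "c > 0" and c: "\<And>v. norm (Q *v v) \<le> c * norm v"
    using linear_bounded_pos[OF matrix_vector_mul_linear, of Q] by blast
  \<comment> \<open>The root bounds the distance from \<open>w\<close> to the unconstrained
    minimizer \<open>m\<close>; the second summand absorbs the constant offset that \<open>d\<close>
    contributes to \<open>m\<close>.\<close>
  define K where "K = sqrt (c * \<rho>\<^sup>2 / l) + norm (matrix_inv Q *v d)"
  have "norm (w + (matrix_inv Q ** C) *v z) \<le> K" if br: "best_response L Q C d z w" for z w
  proof -
    define m where "m = matrix_inv Q *v (- (C *v z + d))"
    have "Q *v m = - (C *v z + d)"
      unfolding m_def by (rule sym_pos_def_matrix_inv[OF Q])
    note sq = objective_complete_square[OF Q this]
    obtain u where u: "u \<in> L" "norm (u - m) \<le> \<rho>" using \<rho> by blast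
    have "objective Q C d z w \<le> objective Q C d z u"
      using br u(1) unfolding best_response_def is_arg_min_def by force
    then have "(w - m) \<bullet> (Q *v (w - m)) \<le> (u - m) \<bullet> (Q *v (u - m))" by (simp add: sq)
    also have "\<dots> \<le> norm (u - m) * norm (Q *v (u - m))" by (rule norm_cauchy_schwarz)
    also have "\<dots> \<le> norm (u - m) * (c * norm (u - m))" by (intro mult_left_mono c) simp
    also have "\<dots> = c * (norm (u - m))\<^sup>2" by (simp add: power2_eq_square)
    also have "\<dots> \<le> c * \<rho>\<^sup>2" using u(2) \<open>c > 0\<close> by (intro mult_left_mono power_mono) auto
    finally have "l * (norm (w - m))\<^sup>2 \<le> c * \<rho>\<^sup>2" using low[of "w - m"] by linarith
    then have "(norm (w - m))\<^sup>2 \<le> c * \<rho>\<^sup>2 / l" using l by (simp add: field_simps)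
    then have wm: "norm (w - m) \<le> sqrt (c * \<rho>\<^sup>2 / l)" by (rule real_le_rsqrt)
    have wz: "w + (matrix_inv Q ** C) *v z = (w - m) - matrix_inv Q *v d"
      by (simp add: m_def linear_neg[OF matrix_vector_mul_linear] linear_diff[OF matrix_vector_mul_linear]
          matrix_vector_mul_assoc)
    then show ?thesis
      using wm norm_triangle_ineq4[of "w - m" "matrix_inv Q *v d"] unfolding wz K_def by linarith
  qed
  then show thesis using that by blast
qed

text \<open>Expansion of the linear part survives the bounded error by the reverse triangle
  inequality.\<close>

lemma best_response_growth:
  fixes L :: "(real ^ 'n) set" and C :: "real ^ 'm ^ 'n"
  assumes "full_rank_lattice L" and "sym_pos_def Q"
    and "\<forall>s \<in> singular_values (matrix_inv Q ** C). s > 1"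
  obtains \<sigma> K where "\<sigma> > 1" "\<And>z w. best_response L Q C d z w \<Longrightarrow> \<sigma> * norm z - K \<le> norm w"
proof -
  obtain \<sigma> where \<sigma>: "\<sigma> > 1" "\<And>v. \<sigma> * norm v \<le> norm ((matrix_inv Q ** C) *v v)"
    using expanding_if_singular_values_gt_1[OF assms(3)] by blast
  obtain K where K: "\<And>z w. best_response L Q C d z w \<Longrightarrow> norm (w + (matrix_inv Q ** C) *v z) \<le> K"
    using best_response_near_linear[OF assms(1,2)] by blast
  have "\<sigma> * norm z - K \<le> norm w" if "best_response L Q C d z w" for z w
    using \<sigma>(2)[of z] K[OF that] norm_diff_ineq[of "(matrix_inv Q ** C) *v z" w]
    by (simp add: add.commute)
  then show thesis using that \<sigma>(1) by blast
qed

section \<open>Escape to infinity\<close>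

lemma expanding_recurrence:
  fixes m :: "nat \<Rightarrow> real"
  assumes \<sigma>: "\<sigma> > 1" and step: "\<And>i. \<sigma> * m i - K \<le> m (Suc i)" and start: "m 0 > K / (\<sigma> - 1)"
  shows "strict_mono m" "filterlim m at_top sequentially"
proof -
  \<comment> \<open>The threshold \<open>K / (\<sigma> - 1)\<close> is the fixed point of
    \<open>t \<mapsto> \<sigma> * t - K\<close>. Above it the guaranteed gain
    \<open>(\<sigma> - 1) * t - K\<close> is positive and increases with \<open>t\<close>, so its
    initial value \<open>g\<close> bounds every later increment from below.\<close>
  define g where "g = (\<sigma> - 1) * m 0 - K"
  have g: "g > 0" using \<sigma> start by (simp add: g_def field_simps)
  have inc: "m i \<ge> m 0 \<and> m (Suc i) \<ge> m i + g" for i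
  proof (induction i)
    case 0
    then show ?case using step[of 0] by (simp add: g_def algebra_simps)
  next
    case (Suc i)
    then have *: "m (Suc i) \<ge> m 0" using g by linarith
    then have "(\<sigma> - 1) * m (Suc i) \<ge> (\<sigma> - 1) * m 0" using \<sigma> by (intro mult_left_mono) auto
    then show ?case using * step[of "Suc i"] by (simp add: g_def algebra_simps)
  qed
  have "m i < m (Suc i)" for i using inc[of i] g by linarith
  then show "strict_mono m" by (rule strict_monoI_Suc)
  have lin: "m 0 + real i * g \<le> m i" for i
  proof (induction i)
    case (Suc i)
    then show ?case using inc[of i] by (simp add: algebra_simps)
  qed simp
  have "filterlim (\<lambda>i. m 0 + real i * g) at_top sequentially"
    using g by (intro filterlim_tendsto_add_at_top[OF tendsto_const]
        filterlim_at_top_mult_tendsto_pos[OF tendsto_const] filterlim_real_sequentially)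
  then show "filterlim m at_top sequentially"
    by (rule filterlim_at_top_mono) (simp add: lin)
qed

theorem theorem3:
  fixes L1 :: "(real ^ 'x) set" and L2 :: "(real ^ 'y) set"
    and Q1 :: "real ^ 'x ^ 'x" and Q2 :: "real ^ 'y ^ 'y"
    and C1 :: "real ^ 'y ^ 'x" and C2 :: "real ^ 'x ^ 'y"
    and d1 :: "real ^ 'x" and d2 :: "real ^ 'y"
  assumes "full_rank_lattice L1" and "full_rank_lattice L2"
    and "sym_pos_def Q1" and "sym_pos_def Q2"
    and "negatively_adequate Q1 Q2 C1 C2"
  shows "finite {(x0, y0). x0 \<in> L1 \<and> y0 \<in> L2 \<and>
           \<not> (\<forall>X Y. best_response_iterates L1 Q1 C1 d1 L2 Q2 C2 d2 x0 y0 X Y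
                    \<longrightarrow> divergent_iterates X Y)}"
proof -
  obtain \<sigma>1 K1 where \<sigma>1: "\<sigma>1 > 1"
    and br1: "\<And>z w. best_response L1 Q1 C1 d1 z w \<Longrightarrow> \<sigma>1 * norm z - K1 \<le> norm w"
    using best_response_growth[OF assms(1,3)] assms(5) unfolding negatively_adequate_def by blast
  obtain \<sigma>2 K2 where \<sigma>2: "\<sigma>2 > 1"
    and br2: "\<And>z w. best_response L2 Q2 C2 d2 z w \<Longrightarrow> \<sigma>2 * norm z - K2 \<le> norm w"
    using best_response_growth[OF assms(2,4)] assms(5) unfolding negatively_adequate_def by blast
  \<comment> \<open>The weaker rate and the larger error give one recurrence valid for both
    players.\<close>
  define \<sigma> where "\<sigma> = min \<sigma>1 \<sigma>2"
  define K where "K = max K1 K2"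
  define M where "M = K / (\<sigma> - 1)"
  have \<sigma>: "\<sigma> > 1" using \<sigma>1 \<sigma>2 by (simp add: \<sigma>_def)
  have div: "divergent_iterates X Y"
    if it: "best_response_iterates L1 Q1 C1 d1 L2 Q2 C2 d2 x0 y0 X Y"
      and big: "max (norm x0) (norm y0) > M" for x0 y0 X Y
  proof -
    \<comment> \<open>Each player reacts to the opponent's previous move, so growth crosses between
      the two components; their maximum obeys a scalar recurrence.\<close>
    define m where "m i = max (norm (X i)) (norm (Y i))" for i
    have step: "\<sigma> * m i - K \<le> m (Suc i)" for i
    proof -
      have "best_response L1 Q1 C1 d1 (Y i) (X (Suc i))" "best_response L2 Q2 C2 d2 (X i) (Y (Suc i))"
        using it unfolding best_response_iterates_def by (auto dest: spec[of _ "Suc i"])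
      moreover have "\<sigma> * norm (Y i) \<le> \<sigma>1 * norm (Y i)" "\<sigma> * norm (X i) \<le> \<sigma>2 * norm (X i)"
        by (simp_all add: \<sigma>_def mult_right_mono)
      ultimately have "\<sigma> * norm (Y i) - K \<le> norm (X (Suc i))" "\<sigma> * norm (X i) - K \<le> norm (Y (Suc i))"
        using br1 br2 unfolding K_def by fastforce+
      then show ?thesis by (auto simp: m_def max_def)
    qed
    have "m 0 > K / (\<sigma> - 1)"
      using it big by (simp add: m_def M_def best_response_iterates_def)
    note m = expanding_recurrence[where m = m, OF \<sigma> step this]
    \<comment> \<open>A repeated pair would repeat a value of the strictly increasing
      \<open>m\<close>.\<close>
    have "\<not> terminates X Y"
      unfolding terminates_def
    proof clarsimp
      fix i k assume "k < i" "X i = X k" "Y i = Y k"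
      then show False using strict_monoD[OF m(1), of k i] by (simp add: m_def)
    qed
    moreover have "m i \<le> norm (X i, Y i)" for i
      using norm_fst_le[of "X i" "Y i"] norm_snd_le[of "Y i" "X i"] by (simp add: m_def)
    then have "filterlim (\<lambda>i. norm (X i, Y i)) at_top sequentially"
      by (intro filterlim_at_top_mono[OF m(2)]) simp
    ultimately show ?thesis unfolding divergent_iterates_def by blast
  qed
  \<comment> \<open>Every exceptional initial point has both components of norm at most
    \<open>M\<close>.\<close>
  have "finite ((L1 \<inter> cball 0 M) \<times> (L2 \<inter> cball 0 M))"
    using assms(1,2) by (simp add: full_rank_lattice_finite_Int_cball)
  then show ?thesis
    by (rule rev_finite_subset) (use div in \<open>force simp: not_le[symmetric]\<close>)
qed

end
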